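(* Let $W$ be a finite real reflection group with set of reflections $T$ and reflection length function $\ell_T$. Let $\mathbf{t}=(t_1,\ldots,t_m)\in T^m$ be a reflection factorization of $w=t_1\cdots t_m$ with $\ell_T(w)<m$. Then either $m=2$, or there exists $\mathbf{t}'=(t'_1,\ldots,t'_m)$ in the Hurwitz orbit of $\mathbf{t}$ such that $\ell_T(t'_1\cdots t'_k)<k$ for some $k\le m-1$.
   Context: A finite real reflection group $W$ is a finite group of linear maps of a finite-dimensional real Euclidean space $V$ generated by orthogonal reflections through hyperplanes (assumed to have no nonzero fixed vector in $V$); $T$ is the set of all reflections in $W$. The absolute (reflection) length of $w\in W$ is $\ell_T(w):=\min\{\ell: w=t_1t_2\cdots t_\ell \text{ for some } t_i\in T\}$ (with $\ell_T(e)=0$). Hurwitz action: write $a^b:=b^{-1}ab$. For $1\le i\le m-1$ the Hurwitz move $\sigma_i$ sends $(t_1,\ldots,t_m)$ to $(t_1,\ldots,t_{i-1},\,t_{i+1},\,t_i^{t_{i+1}},\,t_{i+2},\ldots,t_m)$. It is invertible and preserves the product. The Hurwitz orbit of $\mathbf{t}$ is the set of tuples obtained from it by finite sequences of moves $\sigma_i^{\pm1}$. *)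

theory Defs
  imports "HOL-Analysis.Analysis"
begin

definition reflection_along :: "'a::euclidean_space \<Rightarrow> 'a \<Rightarrow> 'a" where
  "reflection_along v x = x - (2 * (x \<bullet> v) / (v \<bullet> v)) *\<^sub>R v"

definition is_reflection :: "('a::euclidean_space \<Rightarrow> 'a) \<Rightarrow> bool" where
  "is_reflection r \<longleftrightarrow> (\<exists>v. v \<noteq> 0 \<and> r = reflection_along v)"

inductive_set generated_group :: "('a \<Rightarrow> 'a) set \<Rightarrow> ('a \<Rightarrow> 'a) set"
  for S :: "('a \<Rightarrow> 'a) set" where
  one: "id \<in> generated_group S"
| incl: "s \<in> S \<Longrightarrow> s \<in> generated_group S"
| inverse: "g \<in> generated_group S \<Longrightarrow> inv g \<in> generated_group S"
| mult: "g \<in> generated_group S \<Longrightarrow> h \<in> generated_group S \<Longrightarrow> g \<circ> h \<in> generated_group S"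

(* The last conjunct is the standing assumption that W has no nonzero fixed vector. *)
definition finite_reflection_group :: "('a::euclidean_space \<Rightarrow> 'a) set \<Rightarrow> bool" where
  "finite_reflection_group W \<longleftrightarrow>
     finite W \<and>
     (\<exists>S. (\<forall>s\<in>S. is_reflection s) \<and> W = generated_group S) \<and>
     (\<forall>x. (\<forall>w\<in>W. w x = x) \<longrightarrow> x = 0)"

(* T is the set of all reflections in W, not just those of a chosen generating set. *)
definition reflections :: "('a::euclidean_space \<Rightarrow> 'a) set \<Rightarrow> ('a \<Rightarrow> 'a) set" where
  "reflections W = {t \<in> W. is_reflection t}"

definition list_product :: "('a \<Rightarrow> 'a) list \<Rightarrow> 'a \<Rightarrow> 'a" where
  "list_product ts = foldr (\<circ>) ts id"

definition reflection_length :: "('a::euclidean_space \<Rightarrow> 'a) set \<Rightarrow> ('a \<Rightarrow> 'a) \<Rightarrow> nat" where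
  "reflection_length W w =
     (LEAST l. \<exists>ts. length ts = l \<and> set ts \<subseteq> reflections W \<and> w = list_product ts)"

(* a^b = b^{-1} a b *)
definition conj_by :: "('a \<Rightarrow> 'a) \<Rightarrow> ('a \<Rightarrow> 'a) \<Rightarrow> 'a \<Rightarrow> 'a" where
  "conj_by a b = inv b \<circ> a \<circ> b"

(* Lists are indexed from 0, so hurwitz_move i is the move sigma_{i+1}. *)
definition hurwitz_move :: "nat \<Rightarrow> ('a \<Rightarrow> 'a) list \<Rightarrow> ('a \<Rightarrow> 'a) list" where
  "hurwitz_move i ts = ts[i := ts ! Suc i, Suc i := conj_by (ts ! i) (ts ! Suc i)]"

definition hurwitz_rel :: "(('a \<Rightarrow> 'a) list \<times> ('a \<Rightarrow> 'a) list) set" where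
  "hurwitz_rel = {(ts, hurwitz_move i ts) | ts i. Suc i < length ts}"

(* On tuples of bijections each move is injective, so a converse step in the
   orbit of such a tuple is exactly an inverse move. *)
definition hurwitz_orbit :: "('a \<Rightarrow> 'a) list \<Rightarrow> ('a \<Rightarrow> 'a) list set" where
  "hurwitz_orbit ts = (hurwitz_rel \<union> hurwitz_rel\<inverse>)\<^sup>* `` {ts}"

end

theory Submission
  imports Defs
begin

text \<open>Let \<open>w = t\<^sub>1 \<cdots> t\<^sub>m\<close> with \<open>\<ell>(w) < m\<close>, where \<open>\<ell>\<close> denotes reflection length.

  If the Hurwitz orbit contains a tuple with two equal adjacent entries \<open>t, t\<close>, this pair can be
  moved to the front; a prefix of length two then has product \<open>1\<close>, and it is a proper prefix
  unless \<open>m = 2\<close>.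

  The main point is what happens otherwise: then every \<open>t\<^sub>i\<close> fixes each vector \<open>v\<close> that \<open>w\<close> fixes
  (\<open>entries_fix_vector\<close>).  To see this, put \<open>x\<^sub>i = t\<^sub>1 \<cdots> t\<^sub>i\<close> and \<open>f(i) = x\<^sub>i v \<bullet> v\<close>, so that
  \<open>f(i) \<le> v \<bullet> v\<close> with equality at \<open>i = 0\<close> and \<open>i = m\<close>.  A Hurwitz move changes just one of the
  \<open>x\<^sub>i\<close>.  Working in the dihedral group generated by two distinct adjacent reflections, some
  iterate of the move at that place makes \<open>f(i)\<close> at least the average of \<open>f(i - 1)\<close> and
  \<open>f(i + 1)\<close> (\<open>dihedral_hurwitz\<close>).  As \<open>W\<close> is finite, there is a tuple in the orbit that maximises
  \<open>f(0) + \<cdots> + f(m)\<close>.  For it \<open>f\<close> is midpoint concave and reaches its upper bound at both ends; hence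
  \<open>f\<close> is constant and all \<open>x\<^sub>i\<close> fix \<open>v\<close>.

  Deleting a last entry \<open>t\<close> that fixes the fixed space of \<open>w\<close> pointwise makes the fixed space
  strictly larger (\<open>dim_fixed_space_comp_reflection\<close>).  By induction on the number of factors this
  gives Carter's formula that \<open>\<ell>(u)\<close> is the codimension of the fixed space of \<open>u\<close>.  Applied to
  \<open>u = t\<^sub>1 \<cdots> t\<^sub>m\<^sub>-\<^sub>1\<close> it yields \<open>\<ell>(u) < \<ell>(w)\<close>, and therefore \<open>\<ell>(u) < m - 1\<close>.\<close>

section \<open>Reflections\<close>

lemma reflection_along_scaleR:
  fixes v :: "'a::euclidean_space"
  assumes "c \<noteq> 0"
  shows "reflection_along (c *\<^sub>R v) = reflection_along v"
  using assms by (auto simp: reflection_along_def fun_eq_iff)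

lemma reflection_along_unit:
  fixes v :: "'a::euclidean_space"
  assumes "norm v = 1"
  shows "reflection_along v x = x - (2 * (x \<bullet> v)) *\<^sub>R v"
proof -
  have "v \<bullet> v = 1" using assms by (simp add: dot_square_norm)
  then show ?thesis by (simp add: reflection_along_def)
qed

lemma is_reflection_unitE:
  fixes t :: "'a::euclidean_space \<Rightarrow> 'a"
  assumes "is_reflection t"
  obtains v where "norm v = 1" "t = reflection_along v"
proof -
  from assms obtain v where v: "v \<noteq> 0" "t = reflection_along v"
    by (auto simp: is_reflection_def)
  have "norm (v /\<^sub>R norm v) = 1" using v by simp
  moreover have "t = reflection_along (v /\<^sub>R norm v)"
    using v reflection_along_scaleR[of "inverse (norm v)" v] by simp
  ultimately show ?thesis by (rule that)
qed

lemma reflection_along_fixes_iff: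
  fixes v :: "'a::euclidean_space"
  assumes "norm v = 1"
  shows "reflection_along v x = x \<longleftrightarrow> x \<bullet> v = 0"
  using assms by (auto simp: reflection_along_unit)

lemma reflection_orthogonal_transformation:
  fixes t :: "'a::euclidean_space \<Rightarrow> 'a"
  assumes "is_reflection t"
  shows "orthogonal_transformation t"
proof -
  obtain v where v: "norm v = 1" "t = reflection_along v"
    using assms by (rule is_reflection_unitE)
  have vv: "v \<bullet> v = 1" using v by (simp add: dot_square_norm)
  have t: "t x = x - (2 * (x \<bullet> v)) *\<^sub>R v" for x
    using v by (simp add: reflection_along_unit)
  have "linear t"
    by (rule linearI) (auto simp: t algebra_simps inner_simps)
  moreover have "t x \<bullet> t y = x \<bullet> y" for x y
    by (simp add: t inner_simps vv algebra_simps inner_commute)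
  ultimately show ?thesis by (simp add: orthogonal_transformation_def)
qed

lemma reflection_involution:
  fixes t :: "'a::euclidean_space \<Rightarrow> 'a"
  assumes "is_reflection t"
  shows "t (t x) = x"
proof -
  obtain v where v: "norm v = 1" "t = reflection_along v"
    using assms by (rule is_reflection_unitE)
  have "v \<bullet> v = 1" using v by (simp add: dot_square_norm)
  with v show ?thesis by (simp add: reflection_along_unit inner_simps algebra_simps)
qed

lemma reflection_inv:
  fixes t :: "'a::euclidean_space \<Rightarrow> 'a"
  assumes "is_reflection t"
  shows "inv t = t"
  using inv_unique_comp[of t t] reflection_involution[OF assms] by (auto simp: fun_eq_iff)

lemma conj_by_reflection:
  fixes b :: "'a::euclidean_space \<Rightarrow> 'a"
  assumes "is_reflection b"
  shows "conj_by a b = b \<circ> a \<circ> b"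
  by (simp add: conj_by_def reflection_inv[OF assms])

lemma reflection_along_conj:
  fixes b :: "'a::euclidean_space \<Rightarrow> 'a"
  assumes "is_reflection b"
  shows "b \<circ> reflection_along v \<circ> b = reflection_along (b v)"
proof
  fix x
  have orth: "orthogonal_transformation b"
    using assms by (rule reflection_orthogonal_transformation)
  then have lin: "linear b" and inner: "b y \<bullet> b z = y \<bullet> z" for y z
    by (auto simp: orthogonal_transformation_def)
  have "b x \<bullet> v = x \<bullet> b v"
    using inner[of "b x" v] reflection_involution[OF assms] by simp
  then show "(b \<circ> reflection_along v \<circ> b) x = reflection_along (b v) x"
    by (simp add: reflection_along_def linear_diff[OF lin] linear_scale[OF lin] inner
        reflection_involution[OF assms])
qed

lemma is_reflection_conj_by:
  fixes a b :: "'a::euclidean_space \<Rightarrow> 'a"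
  assumes "is_reflection a" "is_reflection b"
  shows "is_reflection (conj_by a b)"
proof -
  obtain v where v: "v \<noteq> 0" "a = reflection_along v"
    using assms(1) by (auto simp: is_reflection_def)
  have "b v \<noteq> 0"
    using reflection_orthogonal_transformation[OF assms(2)] v(1)
    by (metis orthogonal_transformation_norm norm_eq_zero)
  moreover have "conj_by a b = reflection_along (b v)"
    by (simp add: conj_by_reflection[OF assms(2)] v(2) reflection_along_conj[OF assms(2)])
  ultimately show ?thesis by (auto simp: is_reflection_def)
qed

lemma conj_by_in_reflections:
  fixes W :: "('a::euclidean_space \<Rightarrow> 'a) set"
  assumes "finite_reflection_group W" "a \<in> reflections W" "b \<in> reflections W"
  shows "conj_by a b \<in> reflections W"
proof -
  obtain S where S: "W = generated_group S"
    using assms(1) by (auto simp: finite_reflection_group_def)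
  have "conj_by a b \<in> W"
    using assms(2,3) unfolding conj_by_def S reflections_def
    by (auto intro!: generated_group.mult generated_group.inverse)
  then show ?thesis
    using assms(2,3) is_reflection_conj_by by (auto simp: reflections_def)
qed


section \<open>Products and Hurwitz moves\<close>

lemma list_product_simps [simp]:
  "list_product [] = id"
  "list_product (t # ts) = t \<circ> list_product ts"
  by (simp_all add: list_product_def)

lemma list_product_append [simp]:
  "list_product (xs @ ys) = list_product xs \<circ> list_product ys"
  by (induction xs) (auto simp: comp_assoc)

lemma orthogonal_transformation_list_product:
  fixes ts :: "('a::euclidean_space \<Rightarrow> 'a) list"
  assumes "\<forall>t\<in>set ts. is_reflection t"
  shows "orthogonal_transformation (list_product ts)"
  using assms
proof (induction ts)
  case Nil
  then show ?case by (simp add: id_def)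
next
  case (Cons t ts)
  then have "orthogonal_transformation (t \<circ> list_product ts)"
    using orthogonal_transformation_compose[OF reflection_orthogonal_transformation] by auto
  then show ?case by (simp only: list_product_simps)
qed

lemma hurwitz_move_append:
  "hurwitz_move (length xs) (xs @ a # b # ys) = xs @ b # conj_by a b # ys"
  by (simp add: hurwitz_move_def nth_append list_update_append)

lemma hurwitz_relI: "(xs @ a # b # ys, xs @ b # conj_by a b # ys) \<in> hurwitz_rel"
proof -
  have "Suc (length xs) < length (xs @ a # b # ys)" by simp
  then have "(xs @ a # b # ys, hurwitz_move (length xs) (xs @ a # b # ys)) \<in> hurwitz_rel"
    unfolding hurwitz_rel_def by blast
  then show ?thesis by (simp only: hurwitz_move_append)
qed

lemma split_at_adjacent:
  assumes "Suc i < length ts"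
  obtains xs a b ys where "ts = xs @ a # b # ys" "length xs = i"
proof -
  have "ts = take i ts @ ts ! i # ts ! Suc i # drop (Suc (Suc i)) ts"
    using assms by (metis Cons_nth_drop_Suc Suc_lessD append_take_drop_id)
  moreover have "length (take i ts) = i" using assms by simp
  ultimately show ?thesis by (rule that)
qed

lemma hurwitz_relE:
  assumes "(ts, ts') \<in> hurwitz_rel"
  obtains xs a b ys where "ts = xs @ a # b # ys" "ts' = xs @ b # conj_by a b # ys"
proof -
  from assms obtain i where i: "Suc i < length ts" "ts' = hurwitz_move i ts"
    by (auto simp: hurwitz_rel_def)
  from i(1) obtain xs a b ys where "ts = xs @ a # b # ys" "length xs = i"
    by (rule split_at_adjacent)
  then show ?thesis using i(2) hurwitz_move_append[of xs a b ys] that by auto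
qed

text \<open>Reachability by the moves \<open>\<sigma>\<^sub>i\<close> alone leaves a single kind of step to check in inductions.
  Each move permutes the finite set of tuples of reflections of \<open>W\<close>, so that its inverse is one of
  its powers and no tuple is lost.\<close>

definition forward_orbit :: "('a \<Rightarrow> 'a) list \<Rightarrow> ('a \<Rightarrow> 'a) list set" where
  "forward_orbit ts = hurwitz_rel\<^sup>* `` {ts}"

lemma forward_orbit_subset: "forward_orbit ts \<subseteq> hurwitz_orbit ts"
  unfolding forward_orbit_def hurwitz_orbit_def
  by (intro Image_mono rtrancl_mono) auto

lemma forward_orbit_refl: "ts \<in> forward_orbit ts"
  by (simp add: forward_orbit_def)

lemma forward_orbit_trans:
  "ts' \<in> forward_orbit ts \<Longrightarrow> ts'' \<in> forward_orbit ts' \<Longrightarrow> ts'' \<in> forward_orbit ts"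
  by (auto simp: forward_orbit_def intro: rtrancl_trans)

lemma forward_orbit_step: "xs @ b # conj_by a b # ys \<in> forward_orbit (xs @ a # b # ys)"
  using hurwitz_relI[of xs a b ys] by (auto simp: forward_orbit_def)

lemma forward_orbit_length:
  assumes "ts' \<in> forward_orbit ts"
  shows "length ts' = length ts"
proof -
  have "(ts, ts') \<in> hurwitz_rel\<^sup>*" using assms by (simp add: forward_orbit_def)
  then show ?thesis by induction (auto elim!: hurwitz_relE)
qed

lemma forward_orbit_in_reflections:
  fixes W :: "('a::euclidean_space \<Rightarrow> 'a) set"
  assumes "finite_reflection_group W" "ts' \<in> forward_orbit ts" "set ts \<subseteq> reflections W"
  shows "set ts' \<subseteq> reflections W"
proof -
  have "(ts, ts') \<in> hurwitz_rel\<^sup>*" using assms by (simp add: forward_orbit_def)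
  then show ?thesis
    using assms(3)
    by induction (auto elim!: hurwitz_relE intro: conj_by_in_reflections[OF assms(1)])
qed

lemma list_product_conj_by:
  fixes a b :: "'a::euclidean_space \<Rightarrow> 'a"
  assumes "is_reflection b"
  shows "b \<circ> conj_by a b = a \<circ> b"
  by (simp add: conj_by_reflection[OF assms] fun_eq_iff reflection_involution[OF assms])

lemma forward_orbit_list_product:
  fixes W :: "('a::euclidean_space \<Rightarrow> 'a) set"
  assumes W: "finite_reflection_group W" and "ts' \<in> forward_orbit ts" "set ts \<subseteq> reflections W"
  shows "list_product ts' = list_product ts"
proof -
  have "(ts, ts') \<in> hurwitz_rel\<^sup>*" using assms by (simp add: forward_orbit_def)
  then show ?thesis
  proof induction
    case (step us us')
    obtain xs a b ys where us: "us = xs @ a # b # ys" "us' = xs @ b # conj_by a b # ys"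
      using step.hyps(2) by (rule hurwitz_relE)
    have "us \<in> forward_orbit ts" using step.hyps(1) by (simp add: forward_orbit_def)
    then have "is_reflection b"
      using forward_orbit_in_reflections[OF W _ assms(3)] us(1) by (force simp: reflections_def)
    then have "list_product us' = list_product us"
      using list_product_conj_by[of b a] by (simp add: us fun_eq_iff)
    with step.IH show ?case by simp
  qed simp
qed

text \<open>Since \<open>a = b \<circ> (b \<circ> a \<circ> b) \<circ> b\<close>, the vectors fixed by all entries of a tuple can be read off
  from any tuple that it leads to.\<close>

lemma forward_orbit_common_fixed:
  fixes W :: "('a::euclidean_space \<Rightarrow> 'a) set"
  assumes W: "finite_reflection_group W" and "ts' \<in> forward_orbit ts" "set ts \<subseteq> reflections W"
    and "\<forall>t\<in>set ts'. t v = v"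
  shows "\<forall>t\<in>set ts. t v = v"
proof -
  have "(ts, ts') \<in> hurwitz_rel\<^sup>*" using assms by (simp add: forward_orbit_def)
  then have "(\<forall>t\<in>set ts'. t v = v) \<longrightarrow> (\<forall>t\<in>set ts. t v = v)"
  proof induction
    case (step us us')
    obtain xs a b ys where us: "us = xs @ a # b # ys" "us' = xs @ b # conj_by a b # ys"
      using step.hyps(2) by (rule hurwitz_relE)
    have "us \<in> forward_orbit ts" using step.hyps(1) by (simp add: forward_orbit_def)
    then have b: "is_reflection b"
      using forward_orbit_in_reflections[OF W _ assms(3)] us(1) by (force simp: reflections_def)
    have "a v = v" if "b v = v" "conj_by a b v = v"
    proof -
      have "b (a v) = v" using that by (simp add: conj_by_reflection[OF b])
      then have "b (b (a v)) = v" using that(1) by simp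
      then show ?thesis by (simp add: reflection_involution[OF b])
    qed
    then have "(\<forall>t\<in>set us'. t v = v) \<longrightarrow> (\<forall>t\<in>set us. t v = v)"
      unfolding us by (simp only: set_append list.set ball_Un ball_simps) blast
    with step.IH show ?case by blast
  qed simp
  with assms(4) show ?thesis by blast
qed

text \<open>A repeated reflection can be carried leftwards past every entry:
  \<open>(c, t, t)\<close> goes to \<open>(t, t c t, t)\<close> and then to \<open>(t, t, c)\<close>.\<close>

lemma forward_orbit_equal_pair_to_front:
  fixes t :: "'a::euclidean_space \<Rightarrow> 'a"
  assumes "is_reflection t"
  shows "t # t # xs @ ys \<in> forward_orbit (xs @ t # t # ys)"
proof (induction xs arbitrary: ys rule: rev_induct)
  case Nil
  show ?case by (simp add: forward_orbit_refl)
next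
  case (snoc c xs)
  have "conj_by (conj_by c t) t = c"
    by (simp add: conj_by_reflection[OF assms] fun_eq_iff reflection_involution[OF assms])
  then have "xs @ t # t # c # ys \<in> forward_orbit (xs @ t # conj_by c t # t # ys)"
    using forward_orbit_step[of "xs @ [t]" t "conj_by c t" ys] by simp
  moreover have "xs @ t # conj_by c t # t # ys \<in> forward_orbit (xs @ c # t # t # ys)"
    by (rule forward_orbit_step)
  ultimately have "xs @ t # t # c # ys \<in> forward_orbit (xs @ c # t # t # ys)"
    using forward_orbit_trans by blast
  from forward_orbit_trans[OF this snoc.IH[of "c # ys"]] show ?case by simp
qed


section \<open>Two distinct adjacent reflections\<close>

text \<open>Steps of length \<open>2\<psi>\<close> along the circle come within distance \<open>\<psi>\<close> of every point.\<close>

lemma exists_cos_multiple_ge: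
  fixes \<psi> \<theta> :: real
  assumes "0 < \<psi>" "\<psi> \<le> pi" "0 \<le> \<theta>"
  shows "\<exists>n::nat. cos (2 * real n * \<psi> - \<theta>) \<ge> cos \<psi>"
proof -
  define n where "n = nat \<lfloor>(\<theta> + \<psi>) / (2 * \<psi>)\<rfloor>"
  have nonneg: "(\<theta> + \<psi>) / (2 * \<psi>) \<ge> 0" using assms by simp
  then have "real n \<le> (\<theta> + \<psi>) / (2 * \<psi>)" "(\<theta> + \<psi>) / (2 * \<psi>) < real n + 1"
    unfolding n_def by linarith+
  then have "2 * real n * \<psi> \<le> \<theta> + \<psi>" "\<theta> + \<psi> < 2 * real n * \<psi> + 2 * \<psi>"
    using assms(1) by (simp_all add: field_simps)
  then have "\<bar>2 * real n * \<psi> - \<theta>\<bar> \<le> \<psi>" by linarith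
  then have "cos \<psi> \<le> cos \<bar>2 * real n * \<psi> - \<theta>\<bar>"
    using assms(2) by (intro cos_monotone_0_pi_le) auto
  then show ?thesis by auto
qed

lemma polar_coordinates_real:
  fixes A B :: real
  obtains \<theta> where "0 \<le> \<theta>" "A = sqrt (A\<^sup>2 + B\<^sup>2) * cos \<theta>" "B = sqrt (A\<^sup>2 + B\<^sup>2) * sin \<theta>"
proof (cases "A\<^sup>2 + B\<^sup>2 = 0")
  case True
  then show ?thesis using that[of 0] by (simp add: sum_power2_eq_zero_iff)
next
  case False
  define N where "N = sqrt (A\<^sup>2 + B\<^sup>2)"
  have N: "N \<noteq> 0" "N\<^sup>2 = A\<^sup>2 + B\<^sup>2" using False by (auto simp: N_def)
  have "(A / N)\<^sup>2 + (B / N)\<^sup>2 = 1"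
    using N False by (simp add: power_divide flip: add_divide_distrib)
  then obtain \<theta> where "0 \<le> \<theta>" "A / N = cos \<theta>" "B / N = sin \<theta>"
    using sincos_total_2pi[of "A / N" "B / N"] by metis
  then show ?thesis using that[of \<theta>] N(1) unfolding N_def[symmetric]
    by (simp add: field_simps)
qed

text \<open>The planar estimate behind the dihedral lemma below.  The unit vectors \<open>u n\<close> at angle
  \<open>n \<psi>\<close> are roots of a dihedral group, and \<open>p\<close>, \<open>q\<close> are the components of two vectors in its plane.
  The left-hand side is twice the change of \<open>p \<bullet> q\<close> when \<open>p\<close> is reflected along \<open>u n\<close>, and the
  right-hand side is the change when \<open>p\<close> is reflected along \<open>u 1\<close> and then along \<open>u 0\<close>, a rotation
  by \<open>2 \<psi>\<close>.  Adding \<open>2 (p \<bullet> q)\<close> to both turns the left-hand side into \<open>2 N cos (2 n \<psi> - \<theta>)\<close>, with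
  \<open>N\<close> the product of the two norms, and some \<open>n\<close> makes this at least \<open>2 N cos \<psi>\<close>.  The right-hand
  side turns into the inner product of \<open>q\<close> with \<open>p\<close> plus a rotation of \<open>p\<close> by \<open>2 \<psi>\<close>, a vector of
  norm \<open>2 cos \<psi>\<close> times that of \<open>p\<close>, so the Cauchy-Schwarz inequality bounds it by \<open>2 N cos \<psi>\<close>.\<close>

lemma dihedral_planar_estimate:
  fixes \<psi> p1 p2 q1 q2 :: real
  assumes "0 < \<psi>" "\<psi> \<le> pi / 2"
  shows "\<exists>n::nat.
    - 4 * (p1 * cos (n * \<psi>) + p2 * sin (n * \<psi>)) * (q1 * cos (n * \<psi>) + q2 * sin (n * \<psi>))
    \<ge> - 2 * (p1 * cos \<psi> + p2 * sin \<psi>) * (q1 * cos \<psi> + q2 * sin \<psi>) - 2 * p1 * q1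
       + 4 * (p1 * cos \<psi> + p2 * sin \<psi>) * cos \<psi> * q1"
proof -
  define A B where "A = - (p1 * q1 - p2 * q2)" and "B = - (p1 * q2 + p2 * q1)"
  define N where "N = sqrt (A\<^sup>2 + B\<^sup>2)"
  obtain \<theta> where \<theta>: "0 \<le> \<theta>" "A = N * cos \<theta>" "B = N * sin \<theta>"
    unfolding N_def by (rule polar_coordinates_real)
  obtain n :: nat where n: "cos (2 * real n * \<psi> - \<theta>) \<ge> cos \<psi>"
    using exists_cos_multiple_ge[of \<psi> \<theta>] assms \<theta>(1) by fastforce
  let ?D = "p1 * q1 + p2 * q2"
  define C S where "C = cos (real n * \<psi>)" and "S = sin (real n * \<psi>)"
  have CS: "C\<^sup>2 + S\<^sup>2 = 1" by (simp add: C_def S_def)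
  have angle: "2 * real n * \<psi> = 2 * (real n * \<psi>)" by simp
  have c2: "cos (2 * real n * \<psi>) = C\<^sup>2 - S\<^sup>2" and s2: "sin (2 * real n * \<psi>) = 2 * S * C"
    unfolding angle cos_double sin_double C_def S_def by auto
  have "N * cos (2 * real n * \<psi> - \<theta>) = A * (C\<^sup>2 - S\<^sup>2) + B * (2 * S * C)"
    unfolding cos_diff c2 s2 \<theta>(2,3) by (simp add: algebra_simps)
  also have "\<dots> = - 2 * (p1 * C + p2 * S) * (q1 * C + q2 * S) + ?D * (C\<^sup>2 + S\<^sup>2)"
    unfolding A_def B_def by (simp add: power2_eq_square algebra_simps)
  finally have lhs: "- 2 * (p1 * C + p2 * S) * (q1 * C + q2 * S)
      = N * cos (2 * real n * \<psi> - \<theta>) - ?D"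
    using CS by simp
  have N0: "N \<ge> 0" by (simp add: N_def)
  then have 1: "N * cos (2 * real n * \<psi> - \<theta>) \<ge> N * cos \<psi>"
    using n by (rule mult_left_mono[rotated])
  define c s where "c = cos \<psi>" and "s = sin \<psi>"
  have cs: "s\<^sup>2 = 1 - c\<^sup>2" by (simp add: c_def s_def sin_squared_eq)
  have c0: "c \<ge> 0" unfolding c_def using assms by (intro cos_ge_zero) auto
  let ?E = "c * ?D + s * (p2 * q1 - p1 * q2)"
  have "?E\<^sup>2 \<le> (c\<^sup>2 + s\<^sup>2) * (?D\<^sup>2 + (p2 * q1 - p1 * q2)\<^sup>2)"
  proof -
    have "(c\<^sup>2 + s\<^sup>2) * (?D\<^sup>2 + (p2 * q1 - p1 * q2)\<^sup>2) - ?E\<^sup>2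
        = (c * (p2 * q1 - p1 * q2) - s * ?D)\<^sup>2"
      by algebra
    then show ?thesis using zero_le_power2[of "c * (p2 * q1 - p1 * q2) - s * ?D"] by linarith
  qed
  also have "\<dots> = N\<^sup>2"
  proof -
    have "N\<^sup>2 = A\<^sup>2 + B\<^sup>2" by (simp add: N_def)
    also have "\<dots> = ?D\<^sup>2 + (p2 * q1 - p1 * q2)\<^sup>2" unfolding A_def B_def by algebra
    finally show ?thesis by (simp add: cs)
  qed
  finally have E: "?E \<le> N" using N0 by (metis power2_le_imp_le)
  have "- 2 * (p1 * c + p2 * s) * (q1 * c + q2 * s) - 2 * p1 * q1 + 4 * (p1 * c + p2 * s) * c * q1
      = 2 * c * ?E - 2 * ?D"
    using cs by algebra
  also have "\<dots> \<le> 2 * c * N - 2 * ?D"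
    using mult_left_mono[OF E c0] by simp
  also have "\<dots> \<le> - 4 * (p1 * C + p2 * S) * (q1 * C + q2 * S)"
    using lhs 1 by (simp add: c_def algebra_simps)
  finally show ?thesis unfolding c_def s_def C_def S_def by blast
qed

text \<open>Writing \<open>u n\<close> for the unit vector at angle \<open>n \<psi>\<close>, where \<open>\<psi>\<close> is the angle between the roots of
  \<open>a\<close> and \<open>b\<close>, the moves at one fixed position turn \<open>(a, b)\<close> into each of the pairs
  \<open>(reflection_along (u n), reflection_along (u (n + 1)))\<close>.  The planar estimate selects one whose
  first entry is good for the given \<open>v\<close> and \<open>y\<close>.\<close>

lemma dihedral_hurwitz:
  fixes a b :: "'a::euclidean_space \<Rightarrow> 'a"
  assumes "is_reflection a" "is_reflection b" "a \<noteq> b"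
  obtains a' b' where "\<And>xs ys. xs @ a' # b' # ys \<in> forward_orbit (xs @ a # b # ys)"
    "2 * (a' v \<bullet> y) \<ge> v \<bullet> y + a (b v) \<bullet> y"
proof -
  obtain \<alpha> where \<alpha>: "norm \<alpha> = 1" "a = reflection_along \<alpha>"
    using assms(1) by (rule is_reflection_unitE)
  obtain \<beta>' where \<beta>': "norm \<beta>' = 1" "b = reflection_along \<beta>'"
    using assms(2) by (rule is_reflection_unitE)
  \<comment> \<open>The sign of the second root is chosen so that the angle between the roots is at most
    \<open>pi / 2\<close>, as the planar estimate requires.\<close>
  define \<beta> where "\<beta> = (if \<alpha> \<bullet> \<beta>' \<ge> 0 then \<beta>' else - \<beta>')"
  have \<beta>: "norm \<beta> = 1" "b = reflection_along \<beta>" "\<alpha> \<bullet> \<beta> \<ge> 0"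
    using \<beta>' reflection_along_scaleR[of "-1" \<beta>'] by (auto simp: \<beta>_def)
  have aa: "\<alpha> \<bullet> \<alpha> = 1" and bb: "\<beta> \<bullet> \<beta> = 1"
    using \<alpha>(1) \<beta>(1) by (simp_all add: dot_square_norm)
  define c where "c = \<alpha> \<bullet> \<beta>"
  have c1: "c < 1"
  proof (rule ccontr)
    assume "\<not> c < 1"
    moreover have "(\<alpha> - \<beta>) \<bullet> (\<alpha> - \<beta>) = 2 - 2 * c"
      by (simp add: c_def inner_simps aa bb inner_commute)
    ultimately have "(\<alpha> - \<beta>) \<bullet> (\<alpha> - \<beta>) \<le> 0" by simp
    then have "\<alpha> = \<beta>" by (metis inner_gt_zero_iff not_less right_minus_eq)
    then show False using assms(3) \<alpha> \<beta> by simp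
  qed
  define \<psi> where "\<psi> = arccos c"
  have c0: "c \<ge> 0" using \<beta>(3) by (simp add: c_def)
  have cos\<psi>: "cos \<psi> = c" unfolding \<psi>_def using c0 c1 by (intro cos_arccos) auto
  have \<psi>0: "0 < \<psi>"
    unfolding \<psi>_def using c0 c1 arccos_lt_bounded[of c] by simp
  have \<psi>2: "\<psi> \<le> pi / 2" unfolding \<psi>_def using c0 c1 by (intro arccos_le_pi2) auto
  define s where "s = sin \<psi>"
  have s0: "s > 0" unfolding s_def using \<psi>0 \<psi>2 by (intro sin_gt_zero) auto
  have s2: "s\<^sup>2 = 1 - c\<^sup>2" by (simp add: s_def sin_squared_eq cos\<psi>)
  define e where "e = (1 / s) *\<^sub>R (\<beta> - c *\<^sub>R \<alpha>)"
  have \<beta>e: "\<beta> = c *\<^sub>R \<alpha> + s *\<^sub>R e" using s0 by (simp add: e_def)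
  have ae: "\<alpha> \<bullet> e = 0" by (simp add: e_def inner_simps aa c_def)
  have "s\<^sup>2 * (e \<bullet> e) = (\<beta> - c *\<^sub>R \<alpha>) \<bullet> (\<beta> - c *\<^sub>R \<alpha>)"
    using s0 by (simp add: e_def power2_eq_square)
  also have "\<dots> = 1 - c\<^sup>2"
    by (simp add: inner_simps aa bb inner_commute[of \<beta> \<alpha>] flip: c_def)
       (simp add: power2_eq_square)
  finally have "s\<^sup>2 * (e \<bullet> e) = s\<^sup>2 * 1" by (simp add: s2)
  then have ee: "e \<bullet> e = 1" using s0 by (subst (asm) mult_left_cancel) auto
  define u where "u n = cos (real n * \<psi>) *\<^sub>R \<alpha> + sin (real n * \<psi>) *\<^sub>R e" for n :: nat
  have inner_u: "x \<bullet> u n = (x \<bullet> \<alpha>) * cos (real n * \<psi>) + (x \<bullet> e) * sin (real n * \<psi>)" for x n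
    by (simp add: u_def inner_simps)
  have "u n \<bullet> u n = 1" for n
    by (simp add: u_def inner_simps aa ae ee inner_commute[of e \<alpha>] flip: power2_eq_square)
  then have nu: "norm (u n) = 1" for n by (simp add: norm_eq_sqrt_inner)
  have refl_u: "is_reflection (reflection_along (u n))" for n
    using nu[of n] unfolding is_reflection_def by (metis norm_zero zero_neq_one)
  have u0: "u 0 = \<alpha>" and u1: "u 1 = \<beta>" by (simp_all add: u_def \<beta>e cos\<psi> s_def)
  have uu: "u n \<bullet> u (Suc n) = c" for n
  proof -
    have "u n \<bullet> u (Suc n) = cos (real (Suc n) * \<psi> - real n * \<psi>)"
      unfolding cos_diff by (simp add: u_def inner_simps aa ae ee inner_commute[of e \<alpha>])
    also have "real (Suc n) * \<psi> - real n * \<psi> = \<psi>" by (simp add: algebra_simps)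
    finally show ?thesis by (simp add: cos\<psi>)
  qed
  have next_u: "reflection_along (u (Suc n)) (u n) = - u (Suc (Suc n))" for n
  proof -
    define x where "x = real (Suc n) * \<psi>"
    have xs: "real n * \<psi> = x - \<psi>" "real (Suc (Suc n)) * \<psi> = x + \<psi>"
      by (simp_all add: x_def algebra_simps)
    have "cos (x - \<psi>) + cos (x + \<psi>) = 2 * c * cos x" "sin (x - \<psi>) + sin (x + \<psi>) = 2 * c * sin x"
      by (simp_all add: cos_add cos_diff sin_add sin_diff cos\<psi>)
    then have "(cos (x - \<psi>) + cos (x + \<psi>)) *\<^sub>R \<alpha> + (sin (x - \<psi>) + sin (x + \<psi>)) *\<^sub>R e
        = (2 * c * cos x) *\<^sub>R \<alpha> + (2 * c * sin x) *\<^sub>R e"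
      by simp
    then have "u n + u (Suc (Suc n)) = (2 * c) *\<^sub>R u (Suc n)"
      unfolding u_def xs x_def[symmetric]
      by (simp add: scaleR_add_left scaleR_add_right add_ac)
    then have "u n - (2 * c) *\<^sub>R u (Suc n) = - u (Suc (Suc n))"
      by (metis add_diff_cancel_left' minus_diff_eq)
    then show ?thesis
      by (simp add: reflection_along_unit[OF nu] uu)
  qed
  have conj_u: "conj_by (reflection_along (u n)) (reflection_along (u (Suc n)))
      = reflection_along (u (Suc (Suc n)))" for n
    using reflection_along_scaleR[of "-1" "u (Suc (Suc n))"]
    by (simp add: conj_by_reflection[OF refl_u] reflection_along_conj[OF refl_u] next_u)
  have orbit: "xs @ reflection_along (u n) # reflection_along (u (Suc n)) # ys
      \<in> forward_orbit (xs @ a # b # ys)" for n xs ys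
  proof (induction n)
    case 0
    show ?case using u0 u1 \<alpha>(2) \<beta>(2) by (simp add: forward_orbit_refl)
  next
    case (Suc n)
    then show ?case
      using forward_orbit_step[of xs "reflection_along (u (Suc n))" "reflection_along (u n)" ys]
        forward_orbit_trans unfolding conj_u by blast
  qed
  define p1 p2 q1 q2 where "p1 = v \<bullet> \<alpha>" and "p2 = v \<bullet> e" and "q1 = y \<bullet> \<alpha>" and "q2 = y \<bullet> e"
  have refl_inner: "reflection_along (u n) v \<bullet> y = v \<bullet> y
      - 2 * (p1 * cos (n * \<psi>) + p2 * sin (n * \<psi>)) * (q1 * cos (n * \<psi>) + q2 * sin (n * \<psi>))" for n
    by (simp add: reflection_along_unit[OF nu] inner_simps inner_u[of v] inner_u[of y]
        inner_commute[of "u n" y] p1_def p2_def q1_def q2_def)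
  have vb: "v \<bullet> \<beta> = p1 * cos \<psi> + p2 * sin \<psi>" and yb: "y \<bullet> \<beta> = q1 * cos \<psi> + q2 * sin \<psi>"
    by (simp_all add: \<beta>e inner_simps cos\<psi> s_def p1_def p2_def q1_def q2_def)
  have "a (b v) = v - (2 * (v \<bullet> \<beta>)) *\<^sub>R \<beta> - (2 * (v \<bullet> \<alpha> - 2 * (v \<bullet> \<beta>) * cos \<psi>)) *\<^sub>R \<alpha>"
    by (simp add: \<alpha>(2) \<beta>(2) reflection_along_unit[OF \<alpha>(1)] reflection_along_unit[OF \<beta>(1)]
        inner_simps inner_commute[of \<beta> \<alpha>] cos\<psi> flip: c_def)
  then have "a (b v) \<bullet> y = v \<bullet> y - 2 * (v \<bullet> \<beta>) * (y \<bullet> \<beta>) - 2 * p1 * q1 + 4 * (v \<bullet> \<beta>) * cos \<psi> * q1"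
    by (simp add: inner_simps inner_commute[of \<beta> y] inner_commute[of \<alpha> y] p1_def q1_def)
       (simp add: algebra_simps)
  then have ab: "a (b v) \<bullet> y = v \<bullet> y - 2 * (p1 * cos \<psi> + p2 * sin \<psi>) * (q1 * cos \<psi> + q2 * sin \<psi>)
      - 2 * p1 * q1 + 4 * (p1 * cos \<psi> + p2 * sin \<psi>) * cos \<psi> * q1"
    by (simp add: vb yb)
  obtain n :: nat where
    "- 4 * (p1 * cos (n * \<psi>) + p2 * sin (n * \<psi>)) * (q1 * cos (n * \<psi>) + q2 * sin (n * \<psi>))
    \<ge> - 2 * (p1 * cos \<psi> + p2 * sin \<psi>) * (q1 * cos \<psi> + q2 * sin \<psi>) - 2 * p1 * q1
       + 4 * (p1 * cos \<psi> + p2 * sin \<psi>) * cos \<psi> * q1"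
    using dihedral_planar_estimate[OF \<psi>0 \<psi>2] by blast
  then have "2 * (reflection_along (u n) v \<bullet> y) \<ge> v \<bullet> y + a (b v) \<bullet> y"
    unfolding refl_inner ab by (simp add: algebra_simps)
  with orbit show ?thesis by (rule that)
qed


section \<open>Vectors fixed by the product\<close>

text \<open>The differences \<open>f (i + 1) - f i\<close> decrease from a value that is at most zero, so \<open>f\<close> decreases;
  but it ends at \<open>M\<close>.\<close>

lemma midpoint_concave_eq_endpoints:
  fixes f :: "nat \<Rightarrow> real"
  assumes "\<And>i. i \<le> m \<Longrightarrow> f i \<le> M" "f 0 = M" "f m = M"
    and concave: "\<And>i. Suc i < m \<Longrightarrow> f i + f (Suc (Suc i)) \<le> 2 * f (Suc i)"
    and "i \<le> m"
  shows "f i = M"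
proof -
  have decr: "f (Suc i) \<le> f i" if "i < m" for i
    using that
  proof (induction i)
    case 0
    then show ?case using assms(1)[of 1] assms(2) by simp
  next
    case (Suc i)
    then show ?case using concave[of i] by simp
  qed
  have "f m \<le> f i"
    using \<open>i \<le> m\<close>
  proof (induction rule: inc_induct)
    case (step n)
    then show ?case using decr[of n] by linarith
  qed simp
  with assms(1)[OF \<open>i \<le> m\<close>] assms(3) show ?thesis by simp
qed

definition prefix_score :: "'a::euclidean_space \<Rightarrow> ('a \<Rightarrow> 'a) list \<Rightarrow> nat \<Rightarrow> real" where
  "prefix_score v ts i = list_product (take i ts) v \<bullet> v"

lemma sum_prefix_score_less:
  fixes a b a' b' :: "'a::euclidean_space \<Rightarrow> 'a" and xs ys :: "('a \<Rightarrow> 'a) list"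
  assumes "a' \<circ> b' = a \<circ> b"
    and less: "list_product xs (a v) \<bullet> v < list_product xs (a' v) \<bullet> v"
  defines "us \<equiv> xs @ a # b # ys" and "us' \<equiv> xs @ a' # b' # ys"
  shows "sum (prefix_score v us) {..length us} < sum (prefix_score v us') {..length us}"
proof (rule sum_strict_mono_ex1)
  \<comment> \<open>Only the prefix product ending between the two positions changes.\<close>
  have same: "prefix_score v us i = prefix_score v us' i" if "i \<noteq> Suc (length xs)" for i
  proof (cases "i \<le> length xs")
    case True
    then show ?thesis by (simp add: prefix_score_def us_def us'_def)
  next
    case False
    with that obtain k where k: "i = length xs + Suc (Suc k)"
      by (metis add_Suc_right less_imp_Suc_add not_less_eq not_le linorder_neqE_nat)
    have "a' (b' x) = a (b x)" for x using assms(1) by (metis comp_apply)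
    then show ?thesis by (simp add: prefix_score_def us_def us'_def k)
  qed
  have diff: "prefix_score v us (Suc (length xs)) < prefix_score v us' (Suc (length xs))"
    using less by (simp add: prefix_score_def us_def us'_def)
  show "\<forall>i\<in>{..length us}. prefix_score v us i \<le> prefix_score v us' i"
    using same diff by (metis less_imp_le order_refl)
  show "\<exists>i\<in>{..length us}. prefix_score v us i < prefix_score v us' i"
    using diff by (intro bexI[of _ "Suc (length xs)"]) (auto simp: us_def)
qed simp

definition has_equal_pair :: "('a \<Rightarrow> 'a) list \<Rightarrow> bool" where
  "has_equal_pair ts \<longleftrightarrow> (\<exists>xs a ys. ts = xs @ a # a # ys)"

text \<open>Among the tuples reachable from \<open>ts\<close>, one maximising the total score has a midpoint concave
  score sequence: otherwise the dihedral lemma would increase one of its terms and leave the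
  others alone.  Both ends of the sequence equal \<open>v \<bullet> v\<close>, which bounds every term by the
  Cauchy-Schwarz inequality, so the sequence is constant.  Equality in Cauchy-Schwarz then says
  that all prefix products, hence all entries, fix \<open>v\<close>.\<close>

lemma entries_fix_vector:
  fixes W :: "('a::euclidean_space \<Rightarrow> 'a) set"
  assumes W: "finite_reflection_group W" and ts: "set ts \<subseteq> reflections W"
    and no_pair: "\<forall>us\<in>forward_orbit ts. \<not> has_equal_pair us"
    and fixed: "list_product ts v = v"
  shows "\<forall>t\<in>set ts. t v = v"
proof -
  let ?score = "\<lambda>us. sum (prefix_score v us) {..length ts}"
  have "finite (reflections W)"
    using W by (auto simp: finite_reflection_group_def reflections_def)
  then have "finite {us. set us \<subseteq> reflections W \<and> length us = length ts}"
    by (rule finite_lists_length_eq)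
  moreover have "forward_orbit ts \<subseteq> {us. set us \<subseteq> reflections W \<and> length us = length ts}"
    using forward_orbit_in_reflections[OF W _ ts] forward_orbit_length by blast
  ultimately have "finite (?score ` forward_orbit ts)"
    by (intro finite_imageI) (rule finite_subset)
  moreover have "?score ` forward_orbit ts \<noteq> {}" using forward_orbit_refl by blast
  ultimately have "Max (?score ` forward_orbit ts) \<in> ?score ` forward_orbit ts"
    and "\<And>us. us \<in> forward_orbit ts \<Longrightarrow> ?score us \<le> Max (?score ` forward_orbit ts)"
    by auto
  then obtain us where us: "us \<in> forward_orbit ts"
    and max: "\<And>us'. us' \<in> forward_orbit ts \<Longrightarrow> ?score us' \<le> ?score us"
    by fastforce
  have len: "length us = length ts" using us by (rule forward_orbit_length)
  have usW: "set us \<subseteq> reflections W" using forward_orbit_in_reflections[OF W us ts] .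
  then have refl: "\<forall>t\<in>set us. is_reflection t" by (auto simp: reflections_def)
  have orth: "orthogonal_transformation (list_product (take i us))" for i
    using refl by (intro orthogonal_transformation_list_product) (auto dest: in_set_takeD)
  have prefix_fixed: "list_product (take i us) v = v" if "i \<le> length us" for i
  proof -
    have "prefix_score v us i = v \<bullet> v"
    proof (rule midpoint_concave_eq_endpoints[of "length us" "prefix_score v us"])
      fix i
      have "list_product (take i us) v \<bullet> v \<le> norm (list_product (take i us) v) * norm v"
        by (rule norm_cauchy_schwarz)
      also have "\<dots> = v \<bullet> v"
        using orthogonal_transformation_norm[OF orth] by (simp add: norm_eq_sqrt_inner)
      finally show "prefix_score v us i \<le> v \<bullet> v" by (simp add: prefix_score_def)
    next
      show "prefix_score v us 0 = v \<bullet> v" by (simp add: prefix_score_def)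
      show "prefix_score v us (length us) = v \<bullet> v"
        using forward_orbit_list_product[OF W us ts] fixed by (simp add: prefix_score_def)
      show "i \<le> length us" by fact
    next
      fix i assume "Suc i < length us"
      then obtain xs a b ys where decomp: "us = xs @ a # b # ys" "length xs = i"
        by (rule split_at_adjacent)
      have a: "is_reflection a" and b: "is_reflection b" using refl decomp by auto
      have "a \<noteq> b" using no_pair us decomp by (auto simp: has_equal_pair_def)
      have orth_xs: "orthogonal_transformation (list_product xs)"
        using orth[of i] decomp by simp
      then have "surj (list_product xs)" by (rule orthogonal_transformation_surj)
      then obtain y where y: "list_product xs y = v" by (metis surjD)
      have inner: "list_product xs x \<bullet> v = x \<bullet> y" for x
        using orth_xs y by (metis orthogonal_transformation_def)
      obtain a' b' where orbit: "xs @ a' # b' # ys \<in> forward_orbit us"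
        and pair: "[a', b'] \<in> forward_orbit [a, b]"
        and ge: "2 * (a' v \<bullet> y) \<ge> v \<bullet> y + a (b v) \<bullet> y"
        using dihedral_hurwitz[OF a b \<open>a \<noteq> b\<close>, of v y] decomp(1) by (metis append_Nil)
      have "set [a, b] \<subseteq> reflections W" using usW decomp by auto
      then have ab: "a' \<circ> b' = a \<circ> b"
        using forward_orbit_list_product[OF W pair] by simp
      have "\<not> list_product xs (a v) \<bullet> v < list_product xs (a' v) \<bullet> v"
      proof
        assume "list_product xs (a v) \<bullet> v < list_product xs (a' v) \<bullet> v"
        from sum_prefix_score_less[OF ab this, of ys]
        have "?score us < ?score (xs @ a' # b' # ys)"
          using decomp(1) len by metis
        moreover have "?score (xs @ a' # b' # ys) \<le> ?score us"
          using orbit us by (intro max) (rule forward_orbit_trans)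
        ultimately show False by simp
      qed
      with ge have "v \<bullet> y + a (b v) \<bullet> y \<le> 2 * (a v \<bullet> y)" by (simp add: inner)
      then show "prefix_score v us i + prefix_score v us (Suc (Suc i))
          \<le> 2 * prefix_score v us (Suc i)"
        by (simp add: prefix_score_def decomp flip: decomp(2))
          (simp add: inner)
    qed
    then have "list_product (take i us) v \<bullet> v = v \<bullet> v"
      by (simp add: prefix_score_def)
    moreover have "list_product (take i us) v \<bullet> list_product (take i us) v = v \<bullet> v"
      using orth[of i] by (simp add: orthogonal_transformation_def)
    ultimately have "(list_product (take i us) v - v) \<bullet> (list_product (take i us) v - v) = 0"
      by (simp add: inner_simps inner_commute)
    then show ?thesis by simp
  qed
  have "\<forall>t\<in>set us. t v = v"
  proof
    fix t assume "t \<in> set us"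
    then obtain i where i: "i < length us" "t = us ! i" by (metis in_set_conv_nth)
    have "list_product (take (Suc i) us) v = list_product (take i us) (t v)"
      using i by (simp add: take_Suc_conv_app_nth)
    then have "list_product (take i us) (t v) = list_product (take i us) v"
      using prefix_fixed[of i] prefix_fixed[of "Suc i"] i(1) by simp
    then show "t v = v"
      using orthogonal_transformation_inj[OF orth] by (simp add: inj_eq)
  qed
  with forward_orbit_common_fixed[OF W us ts] show ?thesis by blast
qed


section \<open>Reflection length and the fixed space\<close>

definition fixed_space :: "('a::euclidean_space \<Rightarrow> 'a) \<Rightarrow> 'a set" where
  "fixed_space g = {x. g x = x}"

lemma subspace_fixed_space:
  assumes "orthogonal_transformation g"
  shows "subspace (fixed_space g)"
proof -
  have "linear g" using assms by (simp add: orthogonal_transformation_def)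
  then show ?thesis
    by (auto simp: fixed_space_def subspace_def linear_0 linear_add linear_scale)
qed

lemma dim_Int_hyperplane_ge:
  fixes S :: "'a::euclidean_space set"
  assumes "subspace S" "a \<noteq> 0"
  shows "dim S \<le> dim (S \<inter> {x. a \<bullet> x = 0}) + 1"
proof -
  let ?H = "{x. a \<bullet> x = 0}"
  have "dim {x + y |x y. x \<in> S \<and> y \<in> ?H} + dim (S \<inter> ?H) = dim S + dim ?H"
    using assms(1) subspace_hyperplane by (rule dim_sums_Int)
  moreover have "dim {x + y |x y. x \<in> S \<and> y \<in> ?H} \<le> DIM('a)" by (rule dim_subset_UNIV)
  moreover have "dim ?H = DIM('a) - 1" using assms(2) by (rule dim_hyperplane)
  moreover have "DIM('a) \<ge> 1" by (simp add: Suc_leI)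
  ultimately show ?thesis by linarith
qed

lemma codim_fixed_space_le_length:
  fixes ts :: "('a::euclidean_space \<Rightarrow> 'a) list"
  assumes "\<forall>t\<in>set ts. is_reflection t"
  shows "DIM('a) \<le> dim (fixed_space (list_product ts)) + length ts"
  using assms
proof (induction ts)
  case Nil
  then show ?case by (simp add: fixed_space_def)
next
  case (Cons t ts)
  obtain v where v: "norm v = 1" "t = reflection_along v"
    using Cons.prems by (auto elim: is_reflection_unitE)
  have "v \<noteq> 0" using v by auto
  have sub: "subspace (fixed_space (list_product ts))"
    using Cons.prems by (intro subspace_fixed_space orthogonal_transformation_list_product) auto
  have "fixed_space (list_product ts) \<inter> {x. v \<bullet> x = 0} \<subseteq> fixed_space (list_product (t # ts))"
    using reflection_along_fixes_iff[OF v(1)] v(2) by (auto simp: fixed_space_def inner_commute)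
  then have "dim (fixed_space (list_product ts) \<inter> {x. v \<bullet> x = 0})
      \<le> dim (fixed_space (list_product (t # ts)))"
    by (rule dim_subset)
  moreover have "DIM('a) \<le> dim (fixed_space (list_product ts)) + length ts"
    using Cons by simp
  moreover have "length (t # ts) = length ts + 1" by simp
  ultimately show ?case
    using dim_Int_hyperplane_ge[OF sub \<open>v \<noteq> 0\<close>] by linarith
qed

text \<open>The root \<open>\<alpha>\<close> of \<open>t\<close> is orthogonal to the kernel of \<open>g - 1\<close>, that is, it lies in the range of the
  adjoint, so \<open>\<alpha> = inv g z - z\<close> for some \<open>z\<close>.  As \<open>z\<close> and \<open>z + \<alpha>\<close> have the same norm,
  \<open>t\<close> maps \<open>z\<close> to \<open>z + \<alpha> = inv g z\<close>; hence \<open>g \<circ> t\<close> fixes \<open>z\<close>, which \<open>g\<close> does not.\<close>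

lemma dim_fixed_space_comp_reflection:
  fixes g t :: "'a::euclidean_space \<Rightarrow> 'a"
  assumes g: "orthogonal_transformation g" and t: "is_reflection t"
    and sub: "fixed_space g \<subseteq> fixed_space t"
  shows "dim (fixed_space g) < dim (fixed_space (g \<circ> t))"
proof -
  obtain \<alpha> where \<alpha>: "norm \<alpha> = 1" "t = reflection_along \<alpha>"
    using t by (rule is_reflection_unitE)
  have aa: "\<alpha> \<bullet> \<alpha> = 1" using \<alpha>(1) by (simp add: dot_square_norm)
  have bij: "bij g" using g by (rule orthogonal_transformation_bij)
  have g_inv: "g (inv g x) = x" for x using bij by (simp add: bij_is_surj surj_f_inv_f)
  have lin: "linear g" using g by (simp add: orthogonal_transformation_def)
  have inner: "g x \<bullet> g y = x \<bullet> y" for x y using g by (simp add: orthogonal_transformation_def)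
  let ?f = "\<lambda>x. g x - x" and ?h = "\<lambda>x. inv g x - x"
  have lin_f: "linear ?f" using lin linear_ident by (rule linear_compose_sub)
  have "g x \<bullet> y = x \<bullet> inv g y" for x y using inner[of x "inv g y"] by (simp add: g_inv)
  then have adj: "adjoint ?f = ?h"
    by (intro adjoint_unique) (simp add: inner_simps)
  have range_sub: "subspace (range ?h)"
    unfolding adj[symmetric] using adjoint_linear[OF lin_f]
    by (intro linear_subspace_image) auto
  have "?f -` {0} = fixed_space g" by (auto simp: fixed_space_def)
  then have "fixed_space g = (range ?h)\<^sup>\<bottom>"
    using ker_orthogonal_comp_adjoint[OF lin_f] adj by simp
  then have range_h: "range ?h = (fixed_space g)\<^sup>\<bottom>"
    using orthogonal_comp_self[OF range_sub] by simp
  have "x \<bullet> \<alpha> = 0" if "x \<in> fixed_space g" for x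
    using sub that reflection_along_fixes_iff[OF \<alpha>(1)] \<alpha>(2) by (auto simp: fixed_space_def)
  then have "\<alpha> \<in> range ?h"
    unfolding range_h by (auto simp: orthogonal_comp_def orthogonal_def)
  then obtain z where "\<alpha> = inv g z - z" by blast
  then have z: "inv g z = z + \<alpha>" by simp
  have "(z + \<alpha>) \<bullet> (z + \<alpha>) = z \<bullet> z"
    using inner[of "inv g z" "inv g z"] unfolding g_inv unfolding z by simp
  then have "2 * (z \<bullet> \<alpha>) = - 1" by (simp add: inner_simps aa inner_commute)
  then have "t z = inv g z" by (simp add: \<alpha>(2) reflection_along_unit[OF \<alpha>(1)] z)
  then have z_in: "z \<in> fixed_space (g \<circ> t)" by (simp add: fixed_space_def g_inv)
  have z_notin: "z \<notin> fixed_space g"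
  proof
    assume "z \<in> fixed_space g"
    then have "inv g z = z" using bij by (metis (mono_tags) bij_inv_eq_iff fixed_space_def mem_Collect_eq)
    then show False using z aa by simp
  qed
  have subset: "fixed_space g \<subseteq> fixed_space (g \<circ> t)"
    using sub by (auto simp: fixed_space_def)
  have gt: "orthogonal_transformation (g \<circ> t)"
    using g reflection_orthogonal_transformation[OF t] by (rule orthogonal_transformation_compose)
  have "span (fixed_space g) \<subset> span (fixed_space (g \<circ> t))"
    using subset z_in z_notin subspace_fixed_space[OF g] subspace_fixed_space[OF gt]
    by (auto simp: span_eq_iff[THEN iffD2])
  then show ?thesis by (rule dim_psubset)
qed

lemma reflection_length_le:
  assumes "set ts \<subseteq> reflections W"
  shows "reflection_length W (list_product ts) \<le> length ts"
  unfolding reflection_length_def using assms by (intro Least_le) auto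

lemma reflection_length_witness:
  assumes "set ts \<subseteq> reflections W"
  obtains rs where "set rs \<subseteq> reflections W" "list_product rs = list_product ts"
    "length rs = reflection_length W (list_product ts)"
proof -
  have "\<exists>rs. length rs = reflection_length W (list_product ts) \<and> set rs \<subseteq> reflections W \<and>
      list_product ts = list_product rs"
    unfolding reflection_length_def
    by (rule LeastI[of _ "length ts"]) (use assms in auto)
  then show ?thesis using that by metis
qed

lemma fixed_space_subset_entries:
  fixes W :: "('a::euclidean_space \<Rightarrow> 'a) set"
  assumes "finite_reflection_group W" "set ts \<subseteq> reflections W"
    and "\<forall>us\<in>forward_orbit ts. \<not> has_equal_pair us" "t \<in> set ts"
  shows "fixed_space (list_product ts) \<subseteq> fixed_space t"
  using entries_fix_vector[OF assms(1-3)] assms(4) by (auto simp: fixed_space_def)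

text \<open>This is one half of Carter's formula; the other half is
  \<open>codim_fixed_space_le_length\<close>.  A factorization that leads to a repeated adjacent reflection
  shortens by two without changing its product.  In the remaining case all entries fix the fixed
  space of the product, and deleting the last one enlarges that space.\<close>

lemma reflection_length_le_codim_fixed_space:
  fixes W :: "('a::euclidean_space \<Rightarrow> 'a) set"
  assumes W: "finite_reflection_group W" and "set ts \<subseteq> reflections W"
  shows "reflection_length W (list_product ts) + dim (fixed_space (list_product ts)) \<le> DIM('a)"
  using assms(2)
proof (induction "length ts" arbitrary: ts rule: less_induct)
  case less
  show ?case
  proof (cases "\<exists>us\<in>forward_orbit ts. has_equal_pair us")
    case True
    then obtain xs a ys where orbit: "xs @ a # a # ys \<in> forward_orbit ts"
      by (auto simp: has_equal_pair_def)
    have inW: "set (xs @ a # a # ys) \<subseteq> reflections W"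
      using forward_orbit_in_reflections[OF W orbit less.prems] .
    then have a: "is_reflection a" by (auto simp: reflections_def)
    have "list_product (xs @ a # a # ys) = list_product (xs @ ys)"
      by (simp add: fun_eq_iff reflection_involution[OF a])
    then have "list_product ts = list_product (xs @ ys)"
      using forward_orbit_list_product[OF W orbit less.prems] by simp
    moreover have "length (xs @ ys) < length ts"
      using forward_orbit_length[OF orbit] by simp
    ultimately show ?thesis using less.hyps[of "xs @ ys"] inW by simp
  next
    case False
    show ?thesis
    proof (cases ts rule: rev_cases)
      case Nil
      have "reflection_length W (list_product []) \<le> length ([] :: ('a \<Rightarrow> 'a) list)"
        by (rule reflection_length_le) simp
      then show ?thesis using Nil dim_subset_UNIV[of "fixed_space (id :: 'a \<Rightarrow> 'a)"] by simp
    next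
      case (snoc us t)
      have t: "is_reflection t" and usW: "set us \<subseteq> reflections W"
        using less.prems snoc by (auto simp: reflections_def)
      have "orthogonal_transformation (list_product ts)"
        using less.prems by (intro orthogonal_transformation_list_product) (auto simp: reflections_def)
      moreover have "fixed_space (list_product ts) \<subseteq> fixed_space t"
        using fixed_space_subset_entries[OF W less.prems] False snoc by auto
      ultimately have "dim (fixed_space (list_product ts)) < dim (fixed_space (list_product ts \<circ> t))"
        using t dim_fixed_space_comp_reflection by blast
      moreover have "list_product ts \<circ> t = list_product us"
        by (simp add: snoc fun_eq_iff reflection_involution[OF t])
      ultimately have dims: "dim (fixed_space (list_product ts)) < dim (fixed_space (list_product us))"
        by simp
      obtain rs where rs: "set rs \<subseteq> reflections W" "list_product rs = list_product us"
        "length rs = reflection_length W (list_product us)"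
        using usW by (rule reflection_length_witness)
      have "list_product (rs @ [t]) = list_product ts" by (simp add: rs(2) snoc)
      then have "reflection_length W (list_product ts) \<le> length (rs @ [t])"
        using reflection_length_le[of "rs @ [t]" W] rs(1) less.prems snoc by simp
      then have "reflection_length W (list_product ts) \<le> reflection_length W (list_product us) + 1"
        by (simp add: rs(3))
      then show ?thesis using less.hyps[of us] usW snoc dims by fastforce
    qed
  qed
qed


section \<open>Factorizations that are not reduced\<close>

theorem lemma1p3:
  fixes W :: "('a::euclidean_space \<Rightarrow> 'a) set"
    and w :: "'a \<Rightarrow> 'a"
    and ts :: "('a \<Rightarrow> 'a) list"
    and m :: nat
  assumes "finite_reflection_group W"
    and "length ts = m"
    and "set ts \<subseteq> reflections W"
    and "w = list_product ts"
    and "reflection_length W w < m"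
  shows "m = 2 \<or>
    (\<exists>ts' \<in> hurwitz_orbit ts. \<exists>k. k \<le> m - 1 \<and>
       reflection_length W (list_product (take k ts')) < k)"
proof (cases "\<exists>us\<in>forward_orbit ts. has_equal_pair us")
  case True
  then obtain xs a ys where orbit: "xs @ a # a # ys \<in> forward_orbit ts"
    by (auto simp: has_equal_pair_def)
  have "a \<in> reflections W"
    using forward_orbit_in_reflections[OF assms(1) orbit assms(3)] by simp
  then have a: "is_reflection a" by (simp add: reflections_def)
  have front: "a # a # xs @ ys \<in> forward_orbit ts"
    using orbit forward_orbit_equal_pair_to_front[OF a] by (rule forward_orbit_trans)
  have "list_product (take 2 (a # a # xs @ ys)) = list_product []"
    by (simp add: fun_eq_iff reflection_involution[OF a])
  then have "reflection_length W (list_product (take 2 (a # a # xs @ ys))) < 2"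
    using reflection_length_le[of "[]" W] by simp
  moreover have "2 \<le> m - 1 \<or> m = 2"
    using forward_orbit_length[OF front] assms(2) by (simp only: list.size) linarith
  ultimately show ?thesis using front forward_orbit_subset by blast
next
  case False
  have "ts \<noteq> []" using assms(2,5) by auto
  then obtain us t where snoc: "ts = us @ [t]" by (metis rev_exhaust)
  have t: "is_reflection t" and usW: "set us \<subseteq> reflections W"
    using assms(3) snoc by (auto simp: reflections_def)
  have "orthogonal_transformation w"
    unfolding assms(4) using assms(3)
    by (intro orthogonal_transformation_list_product) (auto simp: reflections_def)
  moreover have "fixed_space w \<subseteq> fixed_space t"
    unfolding assms(4) using fixed_space_subset_entries[OF assms(1,3)] False snoc by auto
  ultimately have "dim (fixed_space w) < dim (fixed_space (w \<circ> t))"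
    using t dim_fixed_space_comp_reflection by blast
  moreover have "w \<circ> t = list_product us"
    by (simp add: assms(4) snoc fun_eq_iff reflection_involution[OF t])
  ultimately have "dim (fixed_space w) < dim (fixed_space (list_product us))" by simp
  moreover have "reflection_length W (list_product us) + dim (fixed_space (list_product us)) \<le> DIM('a)"
    using assms(1) usW by (rule reflection_length_le_codim_fixed_space)
  moreover have "DIM('a) \<le> dim (fixed_space w) + reflection_length W w"
  proof -
    obtain rs where rs: "set rs \<subseteq> reflections W" "list_product rs = list_product ts"
      "length rs = reflection_length W (list_product ts)"
      using assms(3) by (rule reflection_length_witness)
    then show ?thesis
      using codim_fixed_space_le_length[of rs] assms(4) by (auto simp: reflections_def)
  qed
  ultimately have "reflection_length W (list_product us) < m - 1"
    using assms(5) by linarith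
  moreover have "take (m - 1) ts = us" using assms(2) snoc by auto
  moreover have "ts \<in> hurwitz_orbit ts" using forward_orbit_refl forward_orbit_subset by blast
  ultimately show ?thesis by (metis order_refl)
qed

end
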